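(* Let $p$ and $q$ be two weakly comaximal elements of $D$. Suppose that $\deg p$ is even, $\deg q$ is odd, and that either $p$ has a unique root (in $\mathbb{R}$), or $q$ has a unique root $u\in\mathbb{R}$ such that $p(u)$ has the same sign as the leading coefficient of $p$. Then the matrix $\begin{pmatrix} p & q\\ 0 & 0\end{pmatrix}\in M_2(D)$ is a product of idempotent matrices over $D$.
   Context: $D$ denotes the minimal Dress ring of $\mathbb{R}(X)$, i.e. the subring of $\mathbb{R}(X)$ generated by all elements $1/(1+x^2)$ with $x\in\mathbb{R}(X)$. Let $\Gamma$ be the set of polynomials in $\mathbb{R}[X]$ having no roots in $\mathbb{R}$ (including nonzero constants), and $\Gamma^+=\{f\in\mathbb{R}[X] : f(r)>0 \ \forall r\in\mathbb{R}\}$. It is known that $D=\{f/\gamma : f\in\mathbb{R}[X],\ \gamma\in\Gamma,\ \deg f\le\deg\gamma\}$. For a nonzero $p=f/\gamma\in D$, $\deg p=\deg f-\deg\gamma\le 0$; taking $\gamma$ to be a product of monic irreducible polynomials of degree $2$, the leading coefficient of $p$ is the leading coefficient of $f$. Roots are real roots, and "unique root" means exactly one distinct real root, of arbitrary multiplicity. Two polynomials $x,y\in\mathbb{R}[X]$ are weakly comaximal if $\gcd(x,y)\in\Gamma$, i.e. if they have no common real roots. Two elements $p,q\in D$, written as $p=x/\gamma$, $q=y/\gamma$ with $\gamma\in\Gamma^+$ and $x,y\in\mathbb{R}[X]$, are weakly comaximal if $x$ and $y$ are. A matrix $\mathbf{T}$ is idempotent if $\mathbf{T}^2=\mathbf{T}$.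 *)

theory Defs
  imports "HOL-Analysis.Analysis" "HOL-Computational_Algebra.Computational_Algebra"
    "HOL-Computational_Algebra.Field_as_Ring"
begin

text \<open>The field \<open>\<real>(X)\<close> is the type \<^typ>\<open>real poly fract\<close>.\<close>

inductive_set dress_ring :: "real poly fract set" where
  gen: "1 / (1 + x^2) \<in> dress_ring"
| zero: "0 \<in> dress_ring"
| one: "1 \<in> dress_ring"
| diff: "a \<in> dress_ring \<Longrightarrow> b \<in> dress_ring \<Longrightarrow> a - b \<in> dress_ring"
| mult: "a \<in> dress_ring \<Longrightarrow> b \<in> dress_ring \<Longrightarrow> a * b \<in> dress_ring"

definition rootless_polys :: "real poly set" where
  "rootless_polys = {f. \<forall>r. poly f r \<noteq> 0}"

definition positive_polys :: "real poly set" where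
  "positive_polys = {f. \<forall>r. poly f r > 0}"

definition poly_weakly_comaximal :: "real poly \<Rightarrow> real poly \<Rightarrow> bool" where
  "poly_weakly_comaximal x y \<longleftrightarrow> gcd x y \<in> rootless_polys"

definition weakly_comaximal :: "real poly fract \<Rightarrow> real poly fract \<Rightarrow> bool" where
  "weakly_comaximal p q \<longleftrightarrow>
     (\<exists>x y \<gamma>. \<gamma> \<in> positive_polys \<and> p = Fract x \<gamma> \<and> q = Fract y \<gamma> \<and> poly_weakly_comaximal x y)"

text \<open>
  Degree, leading coefficient and value are read off the representation of a rational function
  in lowest terms with monic denominator (\<^const>\<open>quot_of_fract\<close>). The lemmas \<open>ratfun_degree_Fract\<close>,
  \<open>ratfun_lead_coeff_Fract\<close> and \<open>ratfun_eval_Fract\<close> give them for arbitrary representations.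
  The degree is meaningful for nonzero arguments only.
\<close>

definition ratfun_degree :: "real poly fract \<Rightarrow> int" where
  "ratfun_degree p = int (degree (fst (quot_of_fract p))) - int (degree (snd (quot_of_fract p)))"

definition ratfun_lead_coeff :: "real poly fract \<Rightarrow> real" where
  "ratfun_lead_coeff p = lead_coeff (fst (quot_of_fract p))"

text \<open>
  Meaningful only where the reduced denominator does not vanish, hence everywhere for elements of
  \<^const>\<open>dress_ring\<close>, see \<open>snd_quot_of_fract_dress_ring\<close>.
\<close>

definition ratfun_eval :: "real poly fract \<Rightarrow> real \<Rightarrow> real" where
  "ratfun_eval p r = poly (fst (quot_of_fract p)) r / poly (snd (quot_of_fract p)) r"

definition ratfun_root :: "real poly fract \<Rightarrow> real \<Rightarrow> bool" where
  "ratfun_root p r \<longleftrightarrow> ratfun_eval p r = 0"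

definition matrix_over :: "'a set \<Rightarrow> 'a^'n^'m \<Rightarrow> bool" where
  "matrix_over R A \<longleftrightarrow> (\<forall>i j. A $ i $ j \<in> R)"

definition idempotent_matrix :: "'a::semiring_1^'n^'n \<Rightarrow> bool" where
  "idempotent_matrix T \<longleftrightarrow> T ** T = T"

definition product_of_idempotents_over :: "'a::semiring_1 set \<Rightarrow> 'a^'n^'n \<Rightarrow> bool" where
  "product_of_idempotents_over R A \<longleftrightarrow>
     (\<exists>Ts. Ts \<noteq> [] \<and> (\<forall>T \<in> set Ts. matrix_over R T \<and> idempotent_matrix T) \<and>
           A = foldr (**) Ts (mat 1))"

subsection \<open>Independence of the representation\<close>

lemma quot_of_fract_Fract_cross:
  fixes f g :: "real poly"
  assumes "g \<noteq> 0"
  shows "fst (quot_of_fract (Fract f g)) * g = f * snd (quot_of_fract (Fract f g))"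
proof -
  have "Fract (fst (quot_of_fract (Fract f g))) (snd (quot_of_fract (Fract f g))) = Fract f g"
    by simp
  then show ?thesis
    using assms by (subst (asm) eq_fract) auto
qed

lemma snd_quot_of_fract_dvd:
  fixes f g :: "real poly"
  assumes "g \<noteq> 0"
  shows "snd (quot_of_fract (Fract f g)) dvd g"
proof -
  have "snd (quot_of_fract (Fract f g)) dvd fst (quot_of_fract (Fract f g)) * g"
    using quot_of_fract_Fract_cross[OF assms, of f] by simp
  moreover have "coprime (snd (quot_of_fract (Fract f g))) (fst (quot_of_fract (Fract f g)))"
    using coprime_quot_of_fract[of "Fract f g"] by (simp add: coprime_commute)
  ultimately show ?thesis
    by (simp add: coprime_dvd_mult_right_iff)
qed

lemma poly_eq_0_dvd:
  fixes h g :: "real poly"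
  assumes "h dvd g" "poly h r = 0"
  shows "poly g r = 0"
  using assms by (meson dvd_trans poly_eq_0_iff_dvd)

lemma ratfun_degree_Fract:
  assumes "f \<noteq> 0" "g \<noteq> 0"
  shows "ratfun_degree (Fract f g) = int (degree f) - int (degree g)"
proof -
  let ?a = "fst (quot_of_fract (Fract f g))" and ?b = "snd (quot_of_fract (Fract f g))"
  have "?a \<noteq> 0"
    using assms by (simp add: Zero_fract_def eq_fract)
  have "degree (?a * g) = degree (f * ?b)"
    using quot_of_fract_Fract_cross[OF assms(2), of f] by simp
  then have "degree ?a + degree g = degree f + degree ?b"
    using assms \<open>?a \<noteq> 0\<close> by (simp add: degree_mult_eq)
  then show ?thesis
    unfolding ratfun_degree_def by linarith
qed

lemma monic_snd_quot_of_fract: "lead_coeff (snd (quot_of_fract (p :: real poly fract))) = 1"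
proof -
  have "unit_factor (snd (quot_of_fract p)) = 1"
    by (rule unit_factor_snd_quot_of_fract)
  then have "[:unit_factor (lead_coeff (snd (quot_of_fract p))):] = 1"
    by (simp add: unit_factor_poly_def monom_0)
  then show ?thesis
    by (simp add: one_pCons)
qed

lemma ratfun_lead_coeff_Fract:
  assumes "g \<noteq> 0"
  shows "ratfun_lead_coeff (Fract f g) = lead_coeff f / lead_coeff g"
proof -
  have "lead_coeff (fst (quot_of_fract (Fract f g)) * g) = lead_coeff (f * snd (quot_of_fract (Fract f g)))"
    using quot_of_fract_Fract_cross[OF assms, of f] by simp
  then have "ratfun_lead_coeff (Fract f g) * lead_coeff g = lead_coeff f"
    unfolding ratfun_lead_coeff_def lead_coeff_mult monic_snd_quot_of_fract by simp
  then show ?thesis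
    using assms by (simp add: field_simps)
qed

lemma ratfun_eval_Fract:
  assumes "poly g r \<noteq> 0"
  shows "ratfun_eval (Fract f g) r = poly f r / poly g r"
proof -
  have "g \<noteq> 0"
    using assms by auto
  have "poly (snd (quot_of_fract (Fract f g))) r \<noteq> 0"
    using poly_eq_0_dvd[OF snd_quot_of_fract_dvd[OF \<open>g \<noteq> 0\<close>, of f]] assms by blast
  moreover have "poly (fst (quot_of_fract (Fract f g))) r * poly g r =
                 poly f r * poly (snd (quot_of_fract (Fract f g))) r"
    using arg_cong[OF quot_of_fract_Fract_cross[OF \<open>g \<noteq> 0\<close>, of f], of "\<lambda>h. poly h r"] by simp
  ultimately show ?thesis
    using assms unfolding ratfun_eval_def by (simp add: field_simps)
qed

lemma dress_ring_denominator:
  assumes "p \<in> dress_ring"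
  shows "\<exists>f g. g \<in> rootless_polys \<and> p = Fract f g"
  using assms
proof induction
  case (gen x)
  define a b where "a = fst (quot_of_fract x)" and "b = snd (quot_of_fract x)"
  have b: "b \<noteq> 0" and x: "x = Fract a b" and cop: "coprime a b"
    by (simp_all add: a_def b_def coprime_quot_of_fract)
  have rl: "poly (a^2 + b^2) r \<noteq> 0" for r
  proof
    assume "poly (a^2 + b^2) r = 0"
    then have "poly a r = 0" "poly b r = 0"
      by (simp_all add: sum_power2_eq_zero_iff)
    then have "[:-r, 1:] dvd 1"
      using cop by (metis coprime_common_divisor poly_eq_0_iff_dvd)
    then show False
      by (metis (no_types) poly_eq_0_iff_dvd poly_1 zero_neq_one)
  qed
  then have nz: "a^2 + b^2 \<noteq> 0"
    by (metis poly_0)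
  have "1 + x^2 = Fract (a^2 + b^2) (b^2)"
    using b by (simp add: x power2_eq_square One_fract_def add.commute)
  then have "1 / (1 + x^2) = Fract (b^2) (a^2 + b^2)"
    using b nz by (simp add: One_fract_def)
  then show ?case
    using rl unfolding rootless_polys_def by blast
next
  case zero
  show ?case
    by (rule exI[of _ 0], rule exI[of _ 1]) (simp add: rootless_polys_def Zero_fract_def)
next
  case one
  show ?case
    by (rule exI[of _ 1], rule exI[of _ 1]) (simp add: rootless_polys_def One_fract_def)
next
  case (diff a b)
  then obtain f g h k where *: "g \<in> rootless_polys" "k \<in> rootless_polys" "a = Fract f g" "b = Fract h k"
    by blast
  then have "g \<noteq> 0" "k \<noteq> 0"
    by (auto simp: rootless_polys_def)
  with * have "a - b = Fract (f * k - h * g) (g * k)" "g * k \<in> rootless_polys"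
    by (auto simp: rootless_polys_def)
  then show ?case
    by blast
next
  case (mult a b)
  then obtain f g h k where *: "g \<in> rootless_polys" "k \<in> rootless_polys" "a = Fract f g" "b = Fract h k"
    by blast
  then have "a * b = Fract (f * h) (g * k)" "g * k \<in> rootless_polys"
    by (auto simp: rootless_polys_def)
  then show ?case
    by blast
qed

lemma snd_quot_of_fract_dress_ring:
  assumes "p \<in> dress_ring"
  shows "snd (quot_of_fract p) \<in> rootless_polys"
proof -
  obtain f g where *: "g \<in> rootless_polys" "p = Fract f g"
    using dress_ring_denominator[OF assms] by blast
  then have "g \<noteq> 0"
    by (auto simp: rootless_polys_def)
  then show ?thesis
    using poly_eq_0_dvd[OF snd_quot_of_fract_dvd[of g f]] * unfolding rootless_polys_def by blast
qed

end

theory Submission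
  imports Defs
begin

text \<open>
  Write \<open>p = f / h\<close> and \<open>q = g / h\<close> with \<open>h\<close> rootless and \<open>f\<close>, \<open>g\<close> without common real roots.
  For polynomials \<open>v\<close>, \<open>w\<close> put \<open>E = f * v + g * w\<close>. The rank one matrix \<open>T\<close> with rows
  \<open>(f * v / E, g * v / E)\<close> and \<open>(f * w / E, g * w / E)\<close> has trace one, so it is idempotent, and every row vector is sent by it to a multiple of
  \<open>(f, g)\<close>; in particular \<open>(d, 0)\<close> goes to \<open>(p, q)\<close> if \<open>d = E / (h * v)\<close>. The matrix with first
  row \<open>(d, 0)\<close> and second row zero is itself a product of two idempotents, for any \<open>d\<close>. So three
  idempotents suffice (\<open>product_of_idempotents_criterion\<close>), provided that \<open>v\<close> and \<open>E\<close> are rootless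
  and that the entries of \<open>T\<close> and \<open>d\<close> have degree at most \<open>0\<close>: by \<open>Fract_mem_dress_ring\<close> this puts
  them into the Dress ring. It remains to find \<open>v\<close> and \<open>w\<close>. Rootless polynomials have even degree,
  so \<open>f\<close> has even and \<open>g\<close> odd degree.

  If \<open>p\<close> has a unique root, then \<open>f\<close>, being of even degree, does not change sign there, and one may
  assume \<open>f \<ge> 0\<close>. Then \<open>E = f * v + g * g\<close> is positive for every positive \<open>v\<close>, since \<open>f\<close> and \<open>g\<close>
  never vanish together; a suitable power of \<open>1 + X^2\<close> as \<open>v\<close> makes the degrees fit
  (\<open>product_of_idempotents_if_first_nonneg\<close>).

  If \<open>q\<close> has a unique root \<open>u\<close>, then \<open>g\<close> changes sign there, so \<open>g * (X - u)\<close> is semidefinite with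
  the only root \<open>u\<close>, and one may assume \<open>f\<close> to be positive at \<open>u\<close>. A large multiple of
  \<open>\<plusminus>(X - u)\<close> as \<open>w\<close> makes \<open>E\<close> positive on any compact set. Near infinity \<open>E\<close> is positive because
  either \<open>g * w\<close> dominates or \<open>f * v\<close> dominates; in the latter case the positivity of the leading
  coefficient of \<open>f\<close> is what is needed, and this is the hypothesis on the sign of \<open>p\<close> at \<open>u\<close>
  (\<open>product_of_idempotents_if_second_sign_changer\<close>).
\<close>

section \<open>Real polynomials and the signs of their values\<close>

lemma rootless_imp_nonzero: "g \<in> rootless_polys \<Longrightarrow> g \<noteq> 0"
  by (auto simp: rootless_polys_def)

lemma rootless_mult_iff: "g * h \<in> rootless_polys \<longleftrightarrow> g \<in> rootless_polys \<and> h \<in> rootless_polys"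
  by (auto simp: rootless_polys_def)

lemma degree_less_2E:
  fixes p :: "'a::zero poly"
  assumes "degree p < 2"
  obtains c d where "p = [:c, d:]"
proof -
  obtain c q where q: "p = pCons c q"
    by (cases p)
  have "degree q = 0"
    using assms by (cases "q = 0") (simp_all add: q)
  then show thesis
    using that q by (metis degree_eq_zeroE)
qed

lemma map_poly_of_real_add:
  "map_poly (of_real :: real \<Rightarrow> complex) (p + q) = map_poly of_real p + map_poly of_real q"
  by (rule poly_eqI) (simp add: coeff_map_poly)

lemma map_poly_of_real_mult:
  "map_poly (of_real :: real \<Rightarrow> complex) (p * q) = map_poly of_real p * map_poly of_real q"
  by (induction p) (simp_all add: map_poly_pCons map_poly_of_real_add map_poly_smult)

text \<open>
  The quadratic factor is the real polynomial with roots \<open>z\<close> and its conjugate, where \<open>z\<close> is a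
  complex root of \<open>g\<close>. It divides \<open>g\<close> because a real polynomial of degree at most one that vanishes
  at a nonreal number is zero, and this applies to the remainder.
\<close>

lemma rootless_quadratic_factor:
  assumes "g \<in> rootless_polys" "degree g > 0"
  obtains a b k where "b \<noteq> 0" "g = ([:-a, 1:]^2 + [:b^2:]) * k"
proof -
  let ?c = "map_poly (of_real :: real \<Rightarrow> complex)"
  have "degree (?c g) > 0"
    using assms(2) by (simp add: degree_map_poly)
  then obtain z where z: "poly (?c g) z = 0"
    using alg_closed_imp_poly_has_root by blast
  define a b where "a = Re z" and "b = Im z"
  have b: "b \<noteq> 0"
  proof
    assume "b = 0"
    then have "z = of_real a"
      by (simp add: a_def b_def complex_eq_iff)
    then have "poly (?c g) (of_real a) = 0"
      using z by simp
    moreover have "poly (?c p) (of_real a) = of_real (poly p a)" for p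
      by (induction p) (simp_all add: map_poly_pCons)
    ultimately show False
      using assms(1) by (simp add: rootless_polys_def)
  qed
  define Q where "Q = [:-a, 1:]^2 + [:b^2:]"
  have Q: "Q = [:a^2 + b^2, -2 * a, 1:]"
    by (simp add: Q_def power2_eq_square)
  have Qz: "poly (?c Q) z = 0"
    by (simp add: Q map_poly_pCons a_def b_def complex_eq_iff power2_eq_square algebra_simps)
  define r where "r = g mod Q"
  have "degree r < 2"
    using degree_mod_less'[of Q g] unfolding r_def by (cases "g mod Q = 0") (auto simp: Q)
  then obtain c d where r: "r = [:c, d:]"
    using degree_less_2E by blast
  have "g = Q * (g div Q) + r"
    by (simp add: r_def)
  then have "poly (?c (Q * (g div Q) + r)) z = 0"
    using z by simp
  then have "poly (?c r) z = 0"
    by (simp add: map_poly_of_real_add map_poly_of_real_mult Qz)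
  then have "of_real c + z * of_real d = 0"
    by (simp add: r map_poly_pCons)
  then have "c = 0 \<and> d = 0"
    using b by (auto simp: b_def complex_eq_iff)
  then have "g = Q * (g div Q)"
    using \<open>g = Q * (g div Q) + r\<close> r by simp
  with b show thesis
    using that unfolding Q_def by blast
qed

lemma poly_sign_constant:
  fixes h :: "real poly"
  assumes "h \<in> rootless_polys"
  shows "(\<forall>x. poly h x > 0) \<or> (\<forall>x. poly h x < 0)"
proof (rule ccontr)
  assume "\<not> ?thesis"
  then obtain x y where "poly h x < 0" "poly h y > 0"
    using assms unfolding rootless_polys_def by (metis (mono_tags) linorder_neqE_linordered_idom mem_Collect_eq)
  then show False
    using poly_IVT_pos[of x y h] poly_IVT_neg[of y x h] assms unfolding rootless_polys_def
    by (cases x y rule: linorder_cases) auto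
qed

lemma even_degree_rootless:
  assumes "g \<in> rootless_polys"
  shows "even (degree g)"
  using assms
proof (induction "degree g" arbitrary: g rule: less_induct)
  case less
  show ?case
  proof (cases "degree g = 0")
    case False
    then obtain a b k where b: "b \<noteq> 0" and g: "g = ([:-a, 1:]^2 + [:b^2:]) * k"
      using rootless_quadratic_factor less.prems by blast
    have "k \<in> rootless_polys"
      using less.prems g rootless_mult_iff by blast
    define Q where "Q = [:-a, 1:]^2 + [:b^2:]"
    have "Q = [:a^2 + b^2, -2 * a, 1:]"
      by (simp add: Q_def power2_eq_square)
    then have "degree Q = 2" "Q \<noteq> 0"
      by simp_all
    then have "degree g = 2 + degree k"
      using g rootless_imp_nonzero[OF \<open>k \<in> rootless_polys\<close>]
      by (simp add: degree_mult_eq flip: Q_def)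
    then show ?thesis
      using less.hyps[of k] \<open>k \<in> rootless_polys\<close> by simp
  qed simp
qed

lemma lead_coeff_pos_if_nonneg:
  fixes h :: "real poly"
  assumes "\<forall>x. poly h x \<ge> 0" "h \<noteq> 0"
  shows "lead_coeff h > 0"
proof (rule ccontr)
  assume "\<not> ?thesis"
  then have lc: "lead_coeff (- h) > 0"
    using assms(2) by (simp add: less_le)
  then obtain n where "poly (- h) n \<ge> lead_coeff (- h)"
    using poly_pinfty_gt_lc by blast
  then show False
    using lc assms(1)[rule_format, of n] by simp
qed

lemma even_degree_pos_outside_compact:
  fixes h :: "real poly"
  assumes "even (degree h)" "lead_coeff h > 0"
  obtains R where "\<And>x. \<bar>x\<bar> \<ge> R \<Longrightarrow> poly h x > 0"
proof -
  have "lead_coeff (pcompose h [:0, -1:]) > 0"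
    using assms by (subst lead_coeff_comp) auto
  then obtain m where m: "\<And>x. x \<ge> m \<Longrightarrow> poly (pcompose h [:0, -1:]) x > 0"
    using poly_pinfty_gt_lc by (meson less_le_trans)
  obtain n where n: "\<And>x. x \<ge> n \<Longrightarrow> poly h x > 0"
    using poly_pinfty_gt_lc assms(2) by (meson less_le_trans)
  show thesis
  proof
    fix x :: real
    assume "\<bar>x\<bar> \<ge> max m n"
    then show "poly h x > 0"
      using m[of "-x"] n[of x] by (cases "x \<ge> 0") (auto simp: poly_pcompose)
  qed
qed

text \<open>
  The cofactor of the power of \<open>X - r\<close> in \<open>h\<close> is rootless, so it has constant sign and even degree;
  hence the multiplicity of \<open>r\<close> is even as well.
\<close>

lemma even_degree_unique_root_semidefinite:
  fixes h :: "real poly"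
  assumes "even (degree h)" "h \<noteq> 0" "\<And>x. poly h x = 0 \<longleftrightarrow> x = r"
  shows "(\<forall>x. poly h x \<ge> 0) \<or> (\<forall>x. poly h x \<le> 0)"
proof -
  obtain k where k: "h = [:-r, 1:] ^ order r h * k" and ndvd: "\<not> [:-r, 1:] dvd k"
    using order_decomp[OF assms(2)] by blast
  have "poly k x \<noteq> 0" for x
  proof (cases "x = r")
    case True
    then show ?thesis
      using ndvd by (simp add: poly_eq_0_iff_dvd)
  next
    case False
    then show ?thesis
      using assms(3)[of x] by (subst (asm) k) auto
  qed
  then have kr: "k \<in> rootless_polys"
    by (simp add: rootless_polys_def)
  have "degree h = order r h + degree k"
    using rootless_imp_nonzero[OF kr] by (subst k) (simp add: degree_mult_eq degree_power_eq)
  then have "even (order r h)"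
    using assms(1) even_degree_rootless[OF kr] by simp
  then have "(x - r) ^ order r h \<ge> 0" for x
    by (simp add: zero_le_even_power)
  moreover have "poly h x = (x - r) ^ order r h * poly k x" for x
    by (subst k) simp
  ultimately show ?thesis
    using poly_sign_constant[OF kr] by (metis less_imp_le mult_nonneg_nonneg mult_nonneg_nonpos)
qed

text \<open>
  The set where \<open>a\<close> is not positive is bounded, hence compact, and \<open>b\<close> has a positive minimum on it.
\<close>

lemma exists_multiple_making_positive:
  fixes a b :: "real poly"
  assumes "even (degree a)" "lead_coeff a > 0"
    and "\<And>x. poly b x \<ge> 0" "\<And>x. poly b x = 0 \<Longrightarrow> poly a x > 0"
  obtains N where "N \<ge> 0" "\<And>x. poly (a + smult N b) x > 0"
proof -
  obtain R where R: "\<And>x. \<bar>x\<bar> \<ge> R \<Longrightarrow> poly a x > 0"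
    using even_degree_pos_outside_compact assms(1,2) by blast
  define S where "S = {x. poly a x \<le> 0}"
  have "S \<subseteq> {-R..R}"
  proof
    fix x
    assume "x \<in> S"
    then show "x \<in> {-R..R}"
      using R[of x] by (cases "\<bar>x\<bar> \<ge> R") (auto simp: S_def)
  qed
  moreover have "closed S"
    unfolding S_def by (intro closed_Collect_le continuous_intros)
  ultimately have S: "compact S"
    by (meson bounded_closed_interval bounded_subset compact_eq_bounded_closed)
  show thesis
  proof (cases "S = {}")
    case True
    then show ?thesis
      using that[of 0] by (auto simp: S_def not_le)
  next
    case False
    obtain s where s: "s \<in> S" "\<And>x. x \<in> S \<Longrightarrow> poly b s \<le> poly b x"
      using continuous_attains_inf[OF S False, of "poly b"] continuous_on_poly[OF continuous_on_id, of S b]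
      by auto
    obtain t where t: "t \<in> S" "\<And>x. x \<in> S \<Longrightarrow> poly a t \<le> poly a x"
      using continuous_attains_inf[OF S False, of "poly a"] continuous_on_poly[OF continuous_on_id, of S a]
      by auto
    have bs: "poly b s > 0"
      using s(1) assms(3,4)[of s] by (fastforce simp: S_def less_le)
    define N where "N = (1 - poly a t) / poly b s"
    have N: "N \<ge> 0"
      using bs t(1) by (simp add: N_def S_def)
    have "poly a x + N * poly b x > 0" for x
    proof (cases "x \<in> S")
      case True
      have "N * poly b s = 1 - poly a t"
        using bs by (simp add: N_def)
      moreover have "N * poly b s \<le> N * poly b x"
        using s(2)[OF True] N by (rule mult_left_mono)
      ultimately show ?thesis
        using t(2)[OF True] by linarith
    next
      case False
      then show ?thesis
        using N assms(3)[of x] by (simp add: S_def add_pos_nonneg)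
    qed
    then show ?thesis
      using that[OF N] by simp
  qed
qed

section \<open>The elements of the Dress ring\<close>

text \<open>
  The leading coefficients of two real squares cannot cancel.
\<close>

lemma degree_sum_of_squares_ge:
  fixes a b :: "real poly"
  shows "degree (b^2) \<le> degree (a^2 + b^2)"
proof (rule ccontr)
  assume less: "\<not> ?thesis"
  let ?n = "degree b"
  have n: "degree (b^2) = 2 * ?n"
    by (cases "b = 0") (simp_all add: degree_power_eq)
  have ab: "degree (a^2) = degree (b^2)"
  proof (rule ccontr)
    assume "degree (a^2) \<noteq> degree (b^2)"
    then show False
      using less degree_add_eq_left[of "b^2" "a^2"] degree_add_eq_right[of "a^2" "b^2"]
      by (cases "degree (a^2)" "degree (b^2)" rule: linorder_cases) auto
  qed
  have "b \<noteq> 0" using less by auto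
  have "coeff (a^2 + b^2) (degree (b^2)) = lead_coeff (a^2) + lead_coeff (b^2)"
    using ab by simp
  also have "\<dots> = (lead_coeff a)^2 + (lead_coeff b)^2"
    by (simp add: lead_coeff_power)
  finally have "coeff (a^2 + b^2) (degree (b^2)) \<noteq> 0"
    using \<open>b \<noteq> 0\<close> by (simp add: sum_power2_eq_zero_iff)
  then show False
    using less le_degree by blast
qed

text \<open>
  The sum of squares in \<open>1 / (1 + (a/b)^2) = b^2 / (a^2 + b^2)\<close> has no real root if \<open>a\<close> and \<open>b\<close> are
  coprime, and the form \<open>f / g\<close> with the stated bound on degrees is stable under the ring operations.
\<close>

lemma dress_ring_representation:
  assumes "p \<in> dress_ring"
  shows "\<exists>f g. g \<in> rootless_polys \<and> degree f \<le> degree g \<and> p = Fract f g"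
  using assms
proof induction
  case (gen x)
  obtain a b where x: "x = Fract a b" and b: "b \<noteq> 0" and cop: "coprime a b"
    using coprime_quot_of_fract[of x] by (metis Fract_quot_of_fract snd_quot_of_fract_nonzero)
  have rl: "poly (a^2 + b^2) r \<noteq> 0" for r
  proof
    assume "poly (a^2 + b^2) r = 0"
    then have "poly a r = 0" "poly b r = 0"
      by (simp_all add: sum_power2_eq_zero_iff)
    then have "[:-r, 1:] dvd 1"
      using cop by (metis coprime_common_divisor poly_eq_0_iff_dvd)
    then show False
      by (metis (no_types) poly_eq_0_iff_dvd poly_1 zero_neq_one)
  qed
  then have nz: "a^2 + b^2 \<noteq> 0"
    by (metis poly_0)
  have "1 + x^2 = Fract (a^2 + b^2) (b^2)"
    using b by (simp add: x power2_eq_square One_fract_def add.commute)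
  then have "1 / (1 + x^2) = Fract (b^2) (a^2 + b^2)"
    using b nz by (simp add: One_fract_def)
  then show ?case
    using rl degree_sum_of_squares_ge unfolding rootless_polys_def by blast
next
  case zero
  show ?case
    by (rule exI[of _ 0], rule exI[of _ 1]) (simp add: rootless_polys_def Zero_fract_def)
next
  case one
  show ?case
    by (rule exI[of _ 1], rule exI[of _ 1]) (simp add: rootless_polys_def One_fract_def)
next
  case (diff a b)
  then obtain f g h k where *: "g \<in> rootless_polys" "k \<in> rootless_polys" "a = Fract f g" "b = Fract h k"
    and d: "degree f \<le> degree g" "degree h \<le> degree k"
    by blast
  have nz: "g \<noteq> 0" "k \<noteq> 0"
    using * rootless_imp_nonzero by blast+
  have "degree (f * k - h * g) \<le> degree (g * k)"
    using d degree_mult_le[of f k] degree_mult_le[of h g]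
    by (intro degree_diff_le) (auto simp: degree_mult_eq nz)
  moreover have "a - b = Fract (f * k - h * g) (g * k)" "g * k \<in> rootless_polys"
    using * nz by (auto simp: rootless_polys_def)
  ultimately show ?case
    by blast
next
  case (mult a b)
  then obtain f g h k where *: "g \<in> rootless_polys" "k \<in> rootless_polys" "a = Fract f g" "b = Fract h k"
    and d: "degree f \<le> degree g" "degree h \<le> degree k"
    by blast
  have nz: "g \<noteq> 0" "k \<noteq> 0"
    using * rootless_imp_nonzero by blast+
  have "degree (f * h) \<le> degree (g * k)"
    using d degree_mult_le[of f h] by (simp add: degree_mult_eq nz)
  moreover have "a * b = Fract (f * h) (g * k)" "g * k \<in> rootless_polys"
    using * by (auto simp: rootless_polys_def)
  ultimately show ?case
    by blast
qed

lemma dress_ring_add: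
  assumes "a \<in> dress_ring" "b \<in> dress_ring"
  shows "a + b \<in> dress_ring"
proof -
  have "a - (0 - b) \<in> dress_ring"
    using assms by (intro dress_ring.diff dress_ring.zero)
  then show ?thesis
    by simp
qed

lemma fract_of_nat_neq_0: "of_nat (Suc n) \<noteq> (0 :: real poly fract)"
proof -
  have "of_nat k = to_fract (of_nat k :: real poly)" for k
    by (induction k) simp_all
  then show ?thesis
    by (metis nat.distinct(1) of_nat_eq_0_iff to_fract_eq_0_iff)
qed

lemma dress_ring_half: "1 / 2 \<in> dress_ring"
  using dress_ring.gen[of 1] by simp

text \<open>
  The Cayley-like substitution \<open>y = (x - 1) / (x + 1)\<close> turns the generator \<open>1 / (1 + y^2)\<close> into
  \<open>1 / 2 + x / (1 + x^2)\<close>; the pole \<open>x = -1\<close> of the substitution is checked directly.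
\<close>

lemma dress_ring_x_over_1_plus_x2:
  assumes "1 + x^2 \<noteq> 0"
  shows "x / (1 + x^2) \<in> dress_ring"
proof -
  have two: "(2 :: real poly fract) \<noteq> 0"
    using fract_of_nat_neq_0[of 1] by simp
  show ?thesis
  proof (cases "x = -1")
    case True
    then have "x / (1 + x^2) = 0 - 1 / 2"
      by simp
    then show ?thesis
      using dress_ring.diff[OF dress_ring.zero dress_ring_half] by simp
  next
    case False
    then have nz: "x + 1 \<noteq> 0"
      by (simp add: add_eq_0_iff2 add.commute)
    define y where "y = (x - 1) / (x + 1)"
    have "1 + y^2 = 2 * (1 + x^2) / (x + 1)^2"
      using nz by (simp add: y_def power_divide field_simps) (simp add: power2_eq_square algebra_simps)
    then have "1 / (1 + y^2) = (x + 1)^2 / (2 * (1 + x^2))"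
      by simp
    also have "\<dots> = 1 / 2 + x / (1 + x^2)"
      using assms two by (simp add: divide_simps) (simp add: power2_eq_square algebra_simps)
    finally have "x / (1 + x^2) = 1 / (1 + y^2) - 1 / 2"
      by simp
    then show ?thesis
      using dress_ring.diff[OF dress_ring.gen dress_ring_half] by simp
  qed
qed

lemma to_fract_const_add: "to_fract [:c + d:] = to_fract [:c:] + to_fract [:d:]" for c d :: real
  by (simp flip: to_fract_add)

lemma to_fract_const_mult: "to_fract [:c * d:] = to_fract [:c:] * to_fract [:d:]" for c d :: real
  by (simp flip: to_fract_mult)

text \<open>
  As \<open>s\<close> runs through the reals, \<open>s / (1 + s^2)\<close> takes all values in the interval from \<open>-1/2\<close> to
  \<open>1/2\<close>. Every real number is a natural multiple of such a value.
\<close>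

lemma dress_ring_const: "to_fract [:c:] \<in> dress_ring"
proof -
  have small: "to_fract [:d:] \<in> dress_ring" if d: "\<bar>d\<bar> \<le> 1 / 2" for d :: real
  proof (cases "d = 0")
    case True
    then show ?thesis
      by (simp add: dress_ring.zero)
  next
    case False
    \<comment> \<open>a solution of the quadratic equation \<open>d * s^2 - s + d = 0\<close>\<close>
    define s where "s = (1 - sqrt (1 - 4 * d^2)) / (2 * d)"
    have "4 * d^2 \<le> 1"
      using power_mono[OF d, of 2] by (simp add: power2_eq_square)
    then have "(sqrt (1 - 4 * d^2))^2 = 1 - 4 * d^2"
      by simp
    moreover have "sqrt (1 - 4 * d^2) = 1 - 2 * d * s"
      using False by (simp add: s_def)
    ultimately have "(1 - 2 * d * s)^2 = 1 - 4 * d^2"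
      by simp
    then have "4 * d * (d * (1 + s^2)) = 4 * d * s"
      by (simp add: power2_eq_square algebra_simps)
    then have ds: "d * (1 + s^2) = s"
      using False by simp
    have nz: "1 + s^2 \<noteq> 0"
      using zero_le_power2[of s] by linarith
    define S where "S = to_fract [:s:]"
    have "S^2 = to_fract [:s^2:]"
      by (simp only: S_def power2_eq_square to_fract_const_mult)
    then have S: "1 + S^2 = to_fract [:1 + s^2:]"
      by (simp only: to_fract_const_add one_pCons[symmetric] to_fract_1)
    have "to_fract [:d:] * (1 + S^2) = S"
      by (simp only: S to_fract_const_mult[symmetric] ds) (simp only: S_def)
    moreover have "1 + S^2 \<noteq> 0"
      using nz by (simp only: S to_fract_eq_0_iff) simp
    ultimately have "to_fract [:d:] = S / (1 + S^2)"
      by (simp add: nonzero_eq_divide_eq)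
    then show ?thesis
      using dress_ring_x_over_1_plus_x2 \<open>1 + S^2 \<noteq> 0\<close> by simp
  qed
  have grow: "to_fract [:of_nat n * d:] \<in> dress_ring" if "\<bar>d\<bar> \<le> 1 / 2" for n and d :: real
  proof (induction n)
    case (Suc n)
    have "to_fract [:of_nat (Suc n) * d:] = to_fract [:d:] + to_fract [:of_nat n * d:]"
      by (simp add: algebra_simps flip: to_fract_const_add)
    then show ?case
      using Suc dress_ring_add small[OF that] by simp
  qed (simp add: dress_ring.zero)
  obtain n :: nat where n: "2 * \<bar>c\<bar> < of_nat n"
    using reals_Archimedean2 by blast
  then have "\<bar>c / of_nat n\<bar> \<le> 1 / 2" "of_nat n \<noteq> (0 :: real)"
    by (auto simp: field_simps abs_if split: if_splits)
  then show ?thesis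
    using grow[of "c / of_nat n" n] by simp
qed

text \<open>
  Split off a quadratic factor \<open>Q\<close> of \<open>g = Q * k\<close>. Division with remainder, \<open>f = f' * Q + r\<close>, gives
  \<open>f / g = f' / k + (r / Q) * (1 / k)\<close>, where the fractions over \<open>k\<close> are in the ring by induction. An
  affine change of variable turns \<open>Q\<close> into a multiple of \<open>1 + y^2\<close>, and \<open>r / Q\<close> into a real linear
  combination of \<open>1 / (1 + y^2)\<close> and \<open>y / (1 + y^2)\<close>.
\<close>

lemma Fract_mem_dress_ring:
  assumes "g \<in> rootless_polys" "degree f \<le> degree g"
  shows "Fract f g \<in> dress_ring"
  using assms
proof (induction "degree g" arbitrary: f g rule: less_induct)
  case less
  show ?case
  proof (cases "degree g = 0")
    case True
    then obtain c d where "g = [:c:]" "f = [:d:]"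
      using less.prems(2) degree_0_id by (metis le_zero_eq)
    then have "c \<noteq> 0"
      using less.prems(1) by (simp add: rootless_polys_def)
    then have "Fract f g = to_fract [:d / c:]"
      using \<open>g = [:c:]\<close> \<open>f = [:d:]\<close> by (simp add: to_fract_def eq_fract)
    then show ?thesis
      by (simp add: dress_ring_const)
  next
    case False
    then obtain a b k where b: "b \<noteq> 0" and g: "g = ([:-a, 1:]^2 + [:b^2:]) * k"
      using rootless_quadratic_factor less.prems by blast
    define Q where "Q = [:-a, 1:]^2 + [:b^2:]"
    have Q: "Q = [:a^2 + b^2, -2 * a, 1:]"
      by (simp add: Q_def power2_eq_square)
    have gQ: "g = Q * k"
      by (simp only: g Q_def)
    have k: "k \<in> rootless_polys"
      using less.prems g rootless_mult_iff by blast
    have nz: "k \<noteq> 0" "Q \<noteq> 0"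
      using rootless_imp_nonzero[OF k] by (simp_all add: Q)
    have dg: "degree g = 2 + degree k"
    proof -
      have "degree Q = 2"
        by (simp add: Q)
      then show ?thesis
        using degree_mult_eq[OF nz(2,1)] gQ by simp
    qed
    define r where "r = f mod Q"
    have "degree r < 2"
      using degree_mod_less'[of Q f] unfolding r_def by (cases "f mod Q = 0") (auto simp: Q)
    then obtain c d where r: "r = [:c, d:]"
      using degree_less_2E by blast
    have fdec: "f = (f div Q) * Q + r"
      by (simp add: r_def)
    have ddiv: "degree (f div Q) \<le> degree k"
    proof (rule ccontr)
      assume big: "\<not> ?thesis"
      then have "degree ((f div Q) * Q) = degree (f div Q) + 2"
        using nz by (subst degree_mult_eq) (auto simp: Q)
      moreover from this have "degree f = degree ((f div Q) * Q)"
        using \<open>degree r < 2\<close> degree_add_eq_left[of r "(f div Q) * Q"] fdec by simp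
      ultimately show False
        using less.prems(2) dg big by simp
    qed
    have "Fract (f div Q) k \<in> dress_ring" "Fract 1 k \<in> dress_ring"
      using less.hyps[of k] dg k ddiv by simp_all
    moreover have "Fract r Q \<in> dress_ring"
    proof -
      define B where "B = to_fract [:b:]"
      define L where "L = [:-a, 1:]"
      define y where "y = to_fract L / B"
      have B: "B \<noteq> 0" "B * to_fract [:1 / b:] = 1"
        using b by (simp_all add: B_def flip: to_fract_const_mult one_pCons)
      have "Q = L * L + [:b * b:]"
        by (simp only: Q_def L_def power2_eq_square)
      then have "to_fract Q = to_fract L * to_fract L + B * B"
        by (simp only: to_fract_add to_fract_mult to_fract_const_mult B_def)
      moreover have LB: "to_fract L = B * y"
        using B by (simp add: y_def)
      ultimately have QB: "to_fract Q = B^2 * (1 + y^2)"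
        by (simp add: power2_eq_square algebra_simps)
      have y: "1 + y^2 \<noteq> 0"
        using nz QB by auto
      have "r = [:c + d * a:] + [:d:] * L"
        by (simp add: r L_def)
      then have "to_fract r = to_fract [:c + d * a:] + to_fract [:d:] * (B * y)"
        by (simp only: to_fract_add to_fract_mult LB)
      moreover have "to_fract [:1 / b:] = 1 / B"
        using B by (simp add: field_simps)
      ultimately have "Fract r Q = to_fract [:c + d * a:] * to_fract [:1 / b:]^2 * (1 / (1 + y^2))
                   + to_fract [:d:] * to_fract [:1 / b:] * (y / (1 + y^2))"
        using B y by (simp add: Fract_conv_to_fract QB add_divide_distrib power2_eq_square)
      then show ?thesis
        using dress_ring_const dress_ring.gen[of y] dress_ring_x_over_1_plus_x2[OF y]
        by (simp add: power2_eq_square dress_ring_add dress_ring.mult del: times_divide_eq_right)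
    qed
    moreover have "Fract f g = Fract (f div Q) k + Fract r Q * Fract 1 k"
    proof -
      have "to_fract f = to_fract (f div Q) * to_fract Q + to_fract r"
        by (metis fdec to_fract_add to_fract_mult)
      then show ?thesis
        using nz by (simp add: Fract_conv_to_fract gQ divide_simps)
    qed
    ultimately show ?thesis
      using dress_ring_add dress_ring.mult by presburger
  qed
qed

section \<open>The factorization\<close>

text \<open>
  The first four bounds on degrees put the entries of the idempotent \<open>T\<close> into the ring, and the last
  one does so for the \<open>d\<close> with \<open>(d, 0)\<close> sent to \<open>(f / h, g / h)\<close> by \<open>T\<close>. Writing
  \<open>(d, 0) = (1, d - 1) B\<close> with an idempotent \<open>B\<close> disposes of the dependence on \<open>d\<close>, since
  \<open>(1, d - 1)\<close> is the first row of an idempotent with second row zero.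
\<close>

lemma product_of_idempotents_criterion:
  fixes f g h v w E :: "real poly"
  assumes rootless: "h \<in> rootless_polys" "v \<in> rootless_polys" "E \<in> rootless_polys"
    and E: "E = f * v + g * w"
    and deg: "degree (f * v) \<le> degree E" "degree (g * v) \<le> degree E"
             "degree (f * w) \<le> degree E" "degree (g * w) \<le> degree E"
    and deg_E: "degree E \<le> degree h + degree v"
  shows "product_of_idempotents_over dress_ring
           (vector [vector [Fract f h, Fract g h], vector [0, 0]] :: real poly fract^2^2)"
proof -
  define F G H V W E' where "F = to_fract f" and "G = to_fract g" and "H = to_fract h"
    and "V = to_fract v" and "W = to_fract w" and "E' = to_fract E"
  note defs = F_def G_def H_def V_def W_def E'_def
  have nz: "H \<noteq> 0" "V \<noteq> 0" "E' \<noteq> 0"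
    using rootless by (auto simp: defs rootless_polys_def)
  have E': "E' = F * V + G * W"
    by (simp add: defs E)
  define d where "d = E' / (H * V)"
  define A B T :: "real poly fract^2^2" where
    "A = vector [vector [1, d - 1], vector [0, 0]]" and
    "B = vector [vector [1, 0], vector [1, 0]]" and
    "T = vector [vector [F * V / E', G * V / E'], vector [F * W / E', G * W / E']]"
  have "d = Fract E (h * v)"
    by (simp add: d_def defs Fract_conv_to_fract)
  then have d: "d \<in> dress_ring"
    using rootless deg_E by (auto intro!: Fract_mem_dress_ring
      simp: rootless_mult_iff degree_mult_eq rootless_imp_nonzero)
  have over: "matrix_over dress_ring A" "matrix_over dress_ring B" "matrix_over dress_ring T"
    using d Fract_mem_dress_ring[OF rootless(3) deg(1)] Fract_mem_dress_ring[OF rootless(3) deg(2)]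
      Fract_mem_dress_ring[OF rootless(3) deg(3)] Fract_mem_dress_ring[OF rootless(3) deg(4)]
    by (auto simp: matrix_over_def forall_2 A_def B_def T_def defs Fract_conv_to_fract
        intro: dress_ring.intros)
  have "idempotent_matrix A" "idempotent_matrix B"
    by (simp_all add: idempotent_matrix_def vec_eq_iff forall_2 matrix_matrix_mult_def sum_2 A_def B_def)
  moreover have "idempotent_matrix T"
  proof -
    have "x * V / E' * (F * y / E') + x * W / E' * (G * y / E') = x * y / E'" for x y
    proof -
      have "x * V / E' * (F * y / E') + x * W / E' * (G * y / E') = x * y * (F * V + G * W) / (E' * E')"
        by (simp add: add_divide_distrib algebra_simps)
      then show ?thesis
        using nz by (simp flip: E')
    qed
    from this[of F V] this[of F W] this[of G V] this[of G W] show ?thesis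
      by (simp add: idempotent_matrix_def vec_eq_iff forall_2 matrix_matrix_mult_def sum_2 T_def
          mult_ac add_ac)
  qed
  moreover have "vector [vector [Fract f h, Fract g h], vector [0, 0]] = foldr (**) [A, B, T] (mat 1)"
  proof -
    have "x / H = x * V / E' + (d - 1) * (x * V / E')" for x
    proof -
      have "y + (d - 1) * y = d * y" for y
        by (simp add: algebra_simps)
      then have "x * V / E' + (d - 1) * (x * V / E') = d * (x * V / E')" .
      also have "\<dots> = x / H"
        using nz by (simp add: d_def)
      finally show ?thesis
        by (rule sym)
    qed
    from this[of F] this[of G] show ?thesis
      by (simp add: vec_eq_iff forall_2 matrix_matrix_mult_def sum_2 mat_def A_def B_def T_def
          Fract_conv_to_fract flip: F_def G_def H_def)
  qed
  ultimately show ?thesis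
    using over unfolding product_of_idempotents_over_def
    by (intro exI[of _ "[A, B, T]"]) simp
qed

text \<open>
  The choice \<open>w = g\<close> makes \<open>E = f * v + g * g\<close> positive for every positive \<open>v\<close>, so that \<open>v\<close> only
  has to adjust degrees.
\<close>

lemma product_of_idempotents_if_first_nonneg:
  fixes f g h :: "real poly"
  assumes h: "h \<in> rootless_polys"
    and deg: "degree f \<le> degree h" "degree g \<le> degree h"
    and parity: "even (degree f)" "odd (degree g)"
    and nonneg: "\<And>x. poly f x \<ge> 0"
    and no_common: "\<And>x. \<not> (poly f x = 0 \<and> poly g x = 0)"
  shows "product_of_idempotents_over dress_ring
           (vector [vector [Fract f h, Fract g h], vector [0, 0]] :: real poly fract^2^2)"
proof -
  have nz: "f \<noteq> 0" "g \<noteq> 0"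
  proof -
    show "g \<noteq> 0"
      using parity by auto
    show "f \<noteq> 0"
    proof
      assume "f = 0"
      then have "g \<in> rootless_polys"
        using no_common by (simp add: rootless_polys_def)
      then show False
        using even_degree_rootless parity by blast
    qed
  qed
  \<comment> \<open>For \<open>degree g < degree f\<close> the exponent has to be large enough for \<open>f * v\<close> to dominate all
    entries; otherwise \<open>degree v = degree g - 1\<close> is forced by the bounds on the degrees of
    \<open>g * v\<close> and \<open>E\<close> if \<open>degree h = degree g + 1\<close>.\<close>
  define j where "j = (if degree g < degree f then degree f else degree g div 2)"
  define v :: "real poly" where "v = [:1, 0, 1:] ^ j"
  have v_pos: "poly v x > 0" for x
    by (simp add: v_def add_pos_nonneg)
  have dv: "degree v = 2 * j" "v \<noteq> 0"
    by (simp_all add: v_def degree_power_eq)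
  define E where "E = f * v + g * g"
  have E_pos: "poly E x > 0" for x
  proof (cases "poly g x = 0")
    case True
    then have "poly f x > 0"
      using no_common nonneg[of x] by (metis less_le)
    then show ?thesis
      using True v_pos by (simp add: E_def)
  next
    case False
    then have "poly g x * poly g x > 0"
      by (auto simp: zero_less_mult_iff)
    then show ?thesis
      using nonneg[of x] v_pos[of x] by (simp add: E_def add_nonneg_pos)
  qed
  have deg_fv: "degree (f * v) = degree f + 2 * j" and deg_gg: "degree (g * g) = 2 * degree g"
    using nz dv by (simp_all add: degree_mult_eq)
  have "degree (f * v) \<le> degree E \<and> degree (g * v) \<le> degree E \<and> degree (f * g) \<le> degree E \<and>
        degree (g * g) \<le> degree E \<and> degree E \<le> degree h + degree v"
  proof (cases "degree g < degree f")
    case True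
    then have "degree E = degree (f * v)"
      unfolding E_def by (intro degree_add_eq_left) (simp add: deg_fv deg_gg j_def)
    then show ?thesis
      using True deg nz dv by (simp add: degree_mult_eq j_def)
  next
    case False
    then have less: "degree f < degree g"
      using parity by (metis linorder_neqE_nat)
    have j: "2 * j + 1 = degree g"
      using False parity(2) by (simp add: j_def)
    then have "degree E = degree (g * g)"
      unfolding E_def using less by (intro degree_add_eq_right) (simp add: deg_fv deg_gg)
    moreover have "degree g + 1 \<le> degree h"
      using deg(2) parity(2) even_degree_rootless[OF h] by (metis Suc_eq_plus1 Suc_leI le_neq_implies_less)
    ultimately show ?thesis
      using less j nz dv by (simp add: degree_mult_eq)
  qed
  moreover have "v \<in> rootless_polys" "E \<in> rootless_polys"
    using v_pos E_pos by (auto simp: rootless_polys_def less_imp_neq[THEN not_sym])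
  ultimately show ?thesis
    using h by (intro product_of_idempotents_criterion[of h v E f g g]) (auto simp: E_def)
qed

text \<open>
  Here \<open>l\<close> is a linear polynomial which changes its sign where \<open>g\<close> does, and \<open>w\<close> is a large multiple
  of \<open>l\<close>. If \<open>g\<close> has larger degree than \<open>f\<close>, then \<open>g * l\<close> decides the sign of \<open>E\<close> near infinity;
  otherwise \<open>f\<close> does, whence the condition on its leading coefficient.
\<close>

lemma product_of_idempotents_if_second_sign_changer:
  fixes f g h l :: "real poly"
  assumes h: "h \<in> rootless_polys"
    and deg: "degree f \<le> degree h" "degree g \<le> degree h"
    and parity: "even (degree f)" "odd (degree g)"
    and l: "degree l = 1"
    and nonneg: "\<And>x. poly (g * l) x \<ge> 0"
    and pos: "\<And>x. poly (g * l) x = 0 \<Longrightarrow> poly f x > 0"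
    and lead: "degree g < degree f \<Longrightarrow> lead_coeff f > 0"
  shows "product_of_idempotents_over dress_ring
           (vector [vector [Fract f h, Fract g h], vector [0, 0]] :: real poly fract^2^2)"
proof (cases "degree g < degree f")
  case True
  have nz: "f \<noteq> 0" "g \<noteq> 0" "l \<noteq> 0"
    using lead[OF True] parity l by auto
  \<comment> \<open>The entry \<open>f * w\<close> with linear \<open>w\<close> requires \<open>v\<close> to have positive degree.\<close>
  define v :: "real poly" where "v = [:1, 0, 1:]"
  have v_pos: "poly v x > 0" for x
    by (simp add: v_def add_pos_nonneg)
  have dv: "degree v = 2" "v \<noteq> 0" "lead_coeff v = 1"
    by (simp_all add: v_def)
  have dfv: "degree (f * v) = degree f + 2"
    using nz dv by (simp add: degree_mult_eq)
  have "lead_coeff (f * v) = lead_coeff f"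
    by (simp only: lead_coeff_mult dv(3) mult_1_right)
  then have "even (degree (f * v))" "lead_coeff (f * v) > 0"
    using parity(1) dfv lead[OF True] by simp_all
  moreover have "poly (f * v) x > 0" if "poly (g * l) x = 0" for x
    using pos[OF that] v_pos by simp
  ultimately obtain N where N: "N \<ge> 0" "\<And>x. poly (f * v + smult N (g * l)) x > 0"
    using exists_multiple_making_positive nonneg by blast
  define w where "w = smult N l"
  define E where "E = f * v + g * w"
  have dw: "degree w \<le> 1"
    using l by (simp add: w_def)
  have "degree (g * w) < degree (f * v)"
    using degree_mult_le[of g w] dw True dfv by linarith
  then have dE: "degree E = degree f + 2"
    unfolding E_def using dfv by (simp add: degree_add_eq_left)
  have "E \<in> rootless_polys" "v \<in> rootless_polys"
    using N(2) v_pos by (auto simp: rootless_polys_def E_def w_def less_imp_neq[THEN not_sym])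
  then show ?thesis
    using h dE dv True deg dw degree_mult_le[of f v] degree_mult_le[of g v] degree_mult_le[of f w]
      degree_mult_le[of g w]
    by (intro product_of_idempotents_criterion[of h v E f g w]) (auto simp: E_def)
next
  case False
  then have less: "degree f < degree g"
    using parity by (metis linorder_neqE_nat)
  have nz: "g \<noteq> 0" "l \<noteq> 0"
    using parity l by auto
  have dgl: "degree (g * l) = degree g + 1"
    using nz l by (simp add: degree_mult_eq)
  have da: "degree (f + g * l) = degree g + 1" "lead_coeff (f + g * l) = lead_coeff (g * l)"
  proof -
    have dlt: "degree f < degree (g * l)"
      using less dgl by simp
    show "degree (f + g * l) = degree g + 1"
      using degree_add_eq_right[OF dlt] dgl by simp
    show "lead_coeff (f + g * l) = lead_coeff (g * l)"
      using dlt by (rule lead_coeff_add_le)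
  qed
  have "lead_coeff (g * l) > 0"
    using lead_coeff_pos_if_nonneg nonneg nz by auto
  then have "even (degree (f + g * l))" "lead_coeff (f + g * l) > 0"
    using da parity by simp_all
  moreover have "poly (f + g * l) x > 0" if "poly (g * l) x = 0" for x
    using pos[OF that] that by auto
  ultimately obtain N where N: "N \<ge> 0" "\<And>x. poly (f + g * l + smult N (g * l)) x > 0"
    using exists_multiple_making_positive nonneg by blast
  \<comment> \<open>The summand \<open>1\<close> is the copy of \<open>g * l\<close> that makes \<open>f + g * l\<close> positive near infinity; it also
    keeps \<open>w\<close> linear if \<open>N = 0\<close>.\<close>
  define w where "w = smult (N + 1) l"
  define E where "E = f * 1 + g * w"
  have E: "E = f + g * l + smult N (g * l)"
    by (simp add: E_def w_def smult_add_left distrib_left)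
  have dw: "degree w = 1"
    using l N(1) by (simp add: w_def)
  then have "degree (g * w) = degree g + 1"
    using nz by (subst degree_mult_eq) auto
  then have dE: "degree E = degree g + 1"
    unfolding E_def using less by (simp add: degree_add_eq_right)
  have "E \<in> rootless_polys" "(1 :: real poly) \<in> rootless_polys"
    using N(2) by (auto simp: rootless_polys_def E less_imp_neq[THEN not_sym])
  moreover have "degree g + 1 \<le> degree h"
    using deg(2) parity(2) even_degree_rootless[OF h] by (metis Suc_eq_plus1 Suc_leI le_neq_implies_less)
  ultimately show ?thesis
    using h dE dw less degree_mult_le[of f w] degree_mult_le[of g w]
    by (intro product_of_idempotents_criterion[of h 1 E f g w]) (auto simp: E_def)
qed

lemma positive_imp_lead_coeff_pos: "h \<in> positive_polys \<Longrightarrow> lead_coeff h > 0"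
  by (intro lead_coeff_pos_if_nonneg) (auto simp: positive_polys_def less_imp_le)

theorem theorem3p10:
  fixes p q :: "real poly fract"
  assumes "p \<in> dress_ring" and "q \<in> dress_ring"
    and "weakly_comaximal p q"
    and "p \<noteq> 0" and "q \<noteq> 0"
    and "even (ratfun_degree p)" and "odd (ratfun_degree q)"
    and "(\<exists>!r. ratfun_root p r) \<or>
         (\<exists>u. (\<forall>r. ratfun_root q r \<longleftrightarrow> r = u) \<and>
              sgn (ratfun_eval p u) = sgn (ratfun_lead_coeff p))"
  shows "product_of_idempotents_over dress_ring
           (vector [vector [p, q], vector [0, 0]] :: real poly fract^2^2)"
proof -
  obtain f g h where h_pos: "h \<in> positive_polys" and p: "p = Fract f h" and q: "q = Fract g h"
    and com: "poly_weakly_comaximal f g"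
    using assms(3) unfolding weakly_comaximal_def by blast
  have h: "h \<in> rootless_polys"
    using h_pos by (auto simp: positive_polys_def rootless_polys_def less_imp_neq[THEN not_sym])
  have h0: "poly h x > 0" "poly h x \<noteq> 0" "h \<noteq> 0" for x
    using h_pos h rootless_imp_nonzero by (auto simp: positive_polys_def rootless_polys_def)
  have nz: "f \<noteq> 0" "g \<noteq> 0"
    using assms(4,5) h0(3) by (auto simp: p q Zero_fract_def eq_fract)
  have no_common: "\<not> (poly f x = 0 \<and> poly g x = 0)" for x
  proof
    assume "poly f x = 0 \<and> poly g x = 0"
    then have "[:-x, 1:] dvd gcd f g"
      by (simp add: poly_eq_0_iff_dvd)
    then have "poly (gcd f g) x = 0"
      by (simp only: poly_eq_0_iff_dvd)
    then show False
      using com by (simp add: poly_weakly_comaximal_def rootless_polys_def)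
  qed
  have deg_le: "degree a \<le> degree h" if "Fract a h \<in> dress_ring" "a \<noteq> 0" for a
  proof -
    obtain b c where bc: "c \<in> rootless_polys" "degree b \<le> degree c" "Fract a h = Fract b c"
      using dress_ring_representation \<open>Fract a h \<in> dress_ring\<close> by blast
    then have c: "c \<noteq> 0"
      using rootless_imp_nonzero by blast
    have eq: "a * c = b * h"
      using bc(3) h0(3) c by (simp add: eq_fract)
    then have "b \<noteq> 0"
      using that c by auto
    have "degree a + degree c = degree b + degree h"
      using eq that(2) c h0(3) \<open>b \<noteq> 0\<close> by (metis degree_mult_eq)
    then show ?thesis
      using bc(2) by simp
  qed
  have deg: "degree f \<le> degree h" "degree g \<le> degree h"
    using deg_le assms(1,2) nz by (simp_all add: p q)
  have parity: "even (degree f)" "odd (degree g)"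
    using assms(6,7) even_degree_rootless[OF h] nz h0(3) by (simp_all add: p q ratfun_degree_Fract)
  have root: "ratfun_root (Fract a h) r \<longleftrightarrow> poly a r = 0" for a r
    by (simp add: ratfun_root_def ratfun_eval_Fract h0)
  \<comment> \<open>Changing the sign of numerators and denominator reduces to the case that \<open>f\<close> is
    nonnegative, or positive at \<open>u\<close>.\<close>
  have flip: "Fract a h = Fract (- a) (- h)" for a
    using h0 by (simp add: eq_fract)
  have h': "- h \<in> rootless_polys"
    using h by (simp add: rootless_polys_def)
  show ?thesis
    using assms(8)
  proof
    assume "\<exists>!r. ratfun_root p r"
    then obtain r where "\<And>x. poly f x = 0 \<longleftrightarrow> x = r"
      by (auto simp: p root)
    then have "(\<forall>x. poly f x \<ge> 0) \<or> (\<forall>x. poly f x \<le> 0)"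
      using even_degree_unique_root_semidefinite parity(1) nz(1) by blast
    then show ?thesis
    proof
      assume "\<forall>x. poly f x \<ge> 0"
      then show ?thesis
        unfolding p q using h deg parity no_common
        by (intro product_of_idempotents_if_first_nonneg) auto
    next
      assume "\<forall>x. poly f x \<le> 0"
      then show ?thesis
        unfolding p q flip[of f] flip[of g] using h' deg parity no_common
        by (intro product_of_idempotents_if_first_nonneg) auto
    qed
  next
    assume "\<exists>u. (\<forall>r. ratfun_root q r \<longleftrightarrow> r = u) \<and>
              sgn (ratfun_eval p u) = sgn (ratfun_lead_coeff p)"
    then obtain u where u: "\<And>x. poly g x = 0 \<longleftrightarrow> x = u"
      and sgn: "sgn (poly f u / poly h u) = sgn (lead_coeff f / lead_coeff h)"
      by (auto simp: p q root ratfun_eval_Fract ratfun_lead_coeff_Fract h0)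
    have lead: "sgn (poly f u) = sgn (lead_coeff f)"
      using sgn h0(1)[of u] positive_imp_lead_coeff_pos[OF h_pos] by (simp add: sgn_divide)
    have fu: "poly f u \<noteq> 0"
      using u no_common by blast
    define l where "l = [:-u, 1:]"
    have "degree (g * l) = degree g + 1"
      using nz by (subst degree_mult_eq) (auto simp: l_def)
    then have "(\<forall>x. poly (g * l) x \<ge> 0) \<or> (\<forall>x. poly (g * l) x \<le> 0)"
      using parity nz u by (intro even_degree_unique_root_semidefinite[where r = u]) (auto simp: l_def)
    then obtain l' where l': "degree l' = 1" "\<And>x. poly (g * l') x \<ge> 0"
      "\<And>x. poly (g * l') x = 0 \<longleftrightarrow> x = u"
    proof
      assume "\<forall>x. poly (g * l) x \<ge> 0"
      then show ?thesis
        using u by (intro that[of l]) (auto simp: l_def)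
    next
      assume "\<forall>x. poly (g * l) x \<le> 0"
      then show ?thesis
        using u by (intro that[of "- l"]) (auto simp: l_def)
    qed
    show ?thesis
    proof (cases "poly f u > 0")
      case True
      then have "lead_coeff f > 0"
        using lead by (simp add: sgn_1_pos)
      then show ?thesis
        unfolding p q using h deg parity l' True
        by (intro product_of_idempotents_if_second_sign_changer[where l = l']) auto
    next
      case False
      then have "poly f u < 0"
        using fu by simp
      then have "lead_coeff f < 0"
        using lead by (metis sgn_less)
      then show ?thesis
        unfolding p q flip[of f] flip[of g] using h' deg parity l' \<open>poly f u < 0\<close>
        by (intro product_of_idempotents_if_second_sign_changer[where l = "- l'"]) auto
    qed
  qed
qed

end
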